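(* Let $\mathcal{V}$ be a separable Hilbert space over $\mathbb{K}=\mathbb{R}$ or $\mathbb{C}$ and let $a:\mathcal{V}\times\mathcal{V}\to\mathbb{K}$ be a continuous sesquilinear form. The following assertions are equivalent: (i) the form $a$ is essentially coercive; (ii) there exist an orthogonal projection $P\in\mathcal{L}(\mathcal{V})$ of finite rank and $\alpha>0$ such that $|a(u,u)|+\|Pu\|_{\mathcal{V}}^2\ge\alpha\|u\|_{\mathcal{V}}^2$ for all $u\in\mathcal{V}$; (iii) there exist a Hilbert space $\mathcal{H}$, a compact operator $J:\mathcal{V}\to\mathcal{H}$ and $\alpha>0$ such that $|a(u,u)|+\|Ju\|_{\mathcal{H}}^2\ge\alpha\|u\|_{\mathcal{V}}^2$ for all $u\in\mathcal{V}$; (iv) there exist a compact operator $\mathcal{K}\in\mathcal{L}(\mathcal{V},\mathcal{V}')$ and $\alpha>0$ such that $|a(u,u)|+|\langle\mathcal{K}u,u\rangle|\ge\alpha\|u\|_{\mathcal{V}}^2$ for all $u\in\mathcal{V}$.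
   Context: A sesquilinear form is linear in the first and antilinear in the second variable (bilinear if $\mathbb{K}=\mathbb{R}$); continuity means $|a(u,v)|\le M\|u\|_{\mathcal{V}}\|v\|_{\mathcal{V}}$ for some $M>0$ and all $u,v$. $\mathcal{V}'$ is the space of continuous antilinear functionals on $\mathcal{V}$ (the usual dual if $\mathbb{K}=\mathbb{R}$), with pairing $\langle L,v\rangle$. The form $a$ is called essentially coercive if for each sequence $(u_n)$ in $\mathcal{V}$ converging weakly to $0$ and such that $\lim_{n\to\infty}a(u_n,u_n)=0$, one has $\lim_{n\to\infty}\|u_n\|_{\mathcal{V}}=0$. *)

theory Defs
  imports "HOL-Analysis.Analysis"
begin

(* The scalar field K: a commutative real normed field with a conjugation.  Lemma
   real_or_complex_cases shows that there are exactly two models, real and complex. *)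

class real_or_complex = real_normed_field +
  fixes conjg :: "'a \<Rightarrow> 'a"
  assumes conjg_add: "conjg (x + y) = conjg x + conjg y"
    and conjg_mult: "conjg (x * y) = conjg x * conjg y"
    and conjg_conjg: "conjg (conjg x) = x"
    and mult_conjg_scaleR: "x * conjg x = (norm x)\<^sup>2 *\<^sub>R 1"

lemma mult_conjg: "x * conjg x = of_real ((norm x)\<^sup>2)" for x :: "'a::real_or_complex"
  by (simp add: mult_conjg_scaleR of_real_def)

instantiation real :: real_or_complex
begin
definition conjg_real :: "real \<Rightarrow> real" where "conjg_real x = x"
instance by standard (simp_all add: conjg_real_def power2_eq_square)
end

instantiation complex :: real_or_complex
begin
definition conjg_complex :: "complex \<Rightarrow> complex" where "conjg_complex = cnj"
instance
  by standard (simp_all add: conjg_complex_def complex_norm_square scaleR_conv_of_real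
      flip: of_real_power)
end

lemma real_or_complex_cases:
  obtains (real) f :: "'k::real_or_complex \<Rightarrow> real"
    where "bij f" "\<And>x y. f (x + y) = f x + f y" "\<And>x y. f (x * y) = f x * f y"
      "\<And>x. norm (f x) = norm x" "\<And>x. f (conjg x) = f x"
  | (complex) g :: "'k::real_or_complex \<Rightarrow> complex"
    where "bij g" "\<And>x y. g (x + y) = g x + g y" "\<And>x y. g (x * y) = g x * g y"
      "\<And>x. norm (g x) = norm x" "\<And>x. g (conjg x) = cnj (g x)"
proof -
  let ?r = "of_real :: real \<Rightarrow> 'k"
  have conjg_real: "conjg (?r r) = ?r r" for r
  proof (cases "r = 0")
    case True
    then show ?thesis using conjg_add[of "0::'k" 0] by simp
  next
    case False
    have "?r r * conjg (?r r) = ?r r * ?r r"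
      using mult_conjg[of "?r r"] by (simp add: power2_eq_square flip: of_real_mult)
    with False show ?thesis by simp
  qed
  have trace: "\<exists>t. x + conjg x = ?r t" for x :: 'k
  proof
    have "(1 + x) * conjg (1 + x) = 1 + (x + conjg x) + x * conjg x"
      using conjg_real[of 1] by (simp add: conjg_add algebra_simps)
    then show "x + conjg x = ?r ((norm (1 + x))\<^sup>2 - 1 - (norm x)\<^sup>2)"
      by (simp add: mult_conjg algebra_simps del: of_real_power)
  qed
  have minus: "conjg (- x) = - conjg x" for x :: 'k
    using conjg_add[of x "- x"] conjg_real[of 0] by (simp add: eq_neg_iff_add_eq_0 add.commute)
  have fixed: "\<exists>s. x = ?r s" if "conjg x = x" for x :: 'k
  proof -
    obtain t where "x + conjg x = ?r t" using trace by blast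
    then have "x + x = ?r t" unfolding that .
    then have "2 * x = 2 * ?r (t / 2)" by simp
    then show ?thesis by (intro exI[of _ "t / 2"]) (simp add: mult.commute)
  qed
  show thesis
  proof (cases "\<forall>x::'k. conjg x = x")
    case True
    define f where "f = inv ?r"
    have s: "surj ?r" using fixed True by (metis surjI surj_def)
    have fr: "f (?r t) = t" for t by (simp add: f_def inj_of_real)
    have rf: "?r (f x) = x" for x by (simp add: f_def s surj_f_inv_f)
    show thesis
    proof (rule real[of f])
      show "bij f" by (metis fr rf bij_iff)
      show "f (x + y) = f x + f y" for x y by (metis fr rf of_real_add)
      show "f (x * y) = f x * f y" for x y by (metis fr rf of_real_mult)
      show "norm (f x) = norm x" for x by (metis rf norm_of_real real_norm_def)
      show "f (conjg x) = f x" for x using True by simp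
    qed
  next
    case False
    then obtain x0 :: 'k where x0: "conjg x0 \<noteq> x0" by auto
    define y where "y = x0 - conjg x0"
    have y0: "y \<noteq> 0" using x0 by (simp add: y_def)
    have cy: "conjg y = - y"
      using conjg_add[of x0 "- conjg x0"] by (simp add: y_def minus conjg_conjg)
    define i where "i = y * ?r (1 / norm y)"
    have ci: "conjg i = - i" by (simp add: i_def conjg_mult cy conjg_real del: of_real_divide)
    have "norm i = 1" using y0 by (simp add: i_def norm_mult norm_divide)
    then have "i * - i = 1" using mult_conjg[of i] ci by simp
    then have ii: "i * i = -1" by (simp add: minus_equation_iff)
    define h where "h = (\<lambda>z. ?r (Re z) + ?r (Im z) * i)"
    have hadd: "h (z + w) = h z + h w" for z w by (simp add: h_def algebra_simps)
    have hmult: "h (z * w) = h z * h w" for z w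
    proof -
      have "h z * h w = ?r (Re z) * ?r (Re w) + ?r (Im z) * ?r (Im w) * (i * i)
          + (?r (Re z) * ?r (Im w) + ?r (Im z) * ?r (Re w)) * i"
        unfolding h_def by (simp only: algebra_simps)
      then show ?thesis unfolding ii by (simp add: h_def)
    qed
    have hcnj: "h (cnj z) = conjg (h z)" for z
      by (simp add: h_def conjg_add conjg_mult conjg_real ci)
    have hnorm: "norm (h z) = norm z" for z
    proof -
      have hr: "h (of_real r) = ?r r" for r by (simp add: h_def)
      have "?r ((norm (h z))\<^sup>2) = h (z * cnj z)"
        by (simp only: mult_conjg[symmetric] hmult hcnj)
      also have "\<dots> = ?r ((norm z)\<^sup>2)" by (simp only: complex_norm_square[symmetric] hr)
      finally have "(norm (h z))\<^sup>2 = (norm z)\<^sup>2" by (simp only: of_real_eq_iff)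
      then show ?thesis by (simp add: power2_eq_iff_nonneg)
    qed
    have hminus: "h (z - w) = h z - h w" for z w by (simp add: h_def algebra_simps)
    have "inj h"
    proof (rule injI)
      fix z w assume "h z = h w"
      then have "norm (z - w) = 0" using hnorm[of "z - w"] hminus[of z w] by simp
      then show "z = w" by simp
    qed
    moreover have "\<exists>z. x = h z" for x
    proof -
      obtain t where t: "x + conjg x = ?r t" using trace by blast
      define w where "w = x - ?r (t / 2)"
      have cx: "conjg x = ?r t - x" using t by (simp add: algebra_simps)
      have "conjg w = conjg x - ?r (t / 2)"
        using conjg_add[of x "- ?r (t / 2)"] conjg_real[of "t / 2"]
        by (simp add: w_def minus del: of_real_divide)
      moreover have "?r t = ?r (t / 2) + ?r (t / 2)" by (simp flip: of_real_add)
      ultimately have cw: "conjg w = - w" by (simp add: w_def cx del: of_real_divide)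
      have "conjg (w * i) = w * i" by (simp add: conjg_mult cw ci)
      then obtain s where s: "w * i = ?r s" using fixed by blast
      have "w = - (w * i) * i" using ii by (simp add: mult.assoc)
      then have "w = ?r (- s) * i" using s by simp
      then have "x = h (Complex (t / 2) (- s))" by (simp add: h_def w_def algebra_simps)
      then show ?thesis by blast
    qed
    ultimately have hb: "bij h" by (metis bij_def surjI surj_def)
    define g where "g = inv h"
    have gh: "g (h z) = z" for z using hb by (simp add: g_def bij_is_inj)
    have hg: "h (g x) = x" for x using hb by (simp add: g_def bij_is_surj surj_f_inv_f)
    show thesis
    proof (rule complex[of g])
      show "bij g" using hb by (simp add: g_def bij_imp_bij_inv)
      show "g (x + y) = g x + g y" for x y by (metis gh hg hadd)
      show "g (x * y) = g x * g y" for x y by (metis gh hg hmult)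
      show "norm (g x) = norm x" for x by (metis hg hnorm)
      show "g (conjg x) = cnj (g x)" for x by (metis gh hg hcnj)
    qed
  qed
qed

(* A Hilbert space over K on a type that is already a Banach space: the norm is the one
   induced by the inner product, which is linear in the first argument. *)

locale hilbert_space = vector_space smul
  for smul :: "'k::real_or_complex \<Rightarrow> 'v::banach \<Rightarrow> 'v" +
  fixes ip :: "'v \<Rightarrow> 'v \<Rightarrow> 'k"
  assumes smul_of_real: "smul (of_real r) u = r *\<^sub>R u"
    and ip_add_left: "ip (u + w) v = ip u v + ip w v"
    and ip_smul_left: "ip (smul c u) v = c * ip u v"
    and ip_commute: "ip v u = conjg (ip u v)"
    and ip_self: "ip u u = of_real ((norm u)\<^sup>2)"

lemma hilbert_space_real_inner:
  "hilbert_space ((*\<^sub>R) :: real \<Rightarrow> 'a::{real_inner,banach} \<Rightarrow> 'a) (\<bullet>)"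
  by standard (auto simp: algebra_simps conjg_real_def inner_commute power2_norm_eq_inner)

definition sesquilinear_form ::
  "('k::real_or_complex \<Rightarrow> 'v::banach \<Rightarrow> 'v) \<Rightarrow> ('v \<Rightarrow> 'v \<Rightarrow> 'k) \<Rightarrow> bool" where
  "sesquilinear_form smul a \<longleftrightarrow>
     (\<forall>u w v. a (u + w) v = a u v + a w v) \<and>
     (\<forall>c u v. a (smul c u) v = c * a u v) \<and>
     (\<forall>u v w. a u (v + w) = a u v + a u w) \<and>
     (\<forall>c u v. a u (smul c v) = conjg c * a u v)"

definition continuous_form :: "('v::banach \<Rightarrow> 'v \<Rightarrow> 'k::real_or_complex) \<Rightarrow> bool" where
  "continuous_form a \<longleftrightarrow> (\<exists>M>0. \<forall>u v. norm (a u v) \<le> M * norm u * norm v)"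

(* V': the continuous antilinear functionals, as a subspace of the space of bounded
   real-linear maps V -> K, whose norm is the operator norm. *)

definition antidual ::
  "('k::real_or_complex \<Rightarrow> 'v::banach \<Rightarrow> 'v) \<Rightarrow> ('v \<Rightarrow>\<^sub>L 'k) set" where
  "antidual smul = {L. \<forall>c v. blinfun_apply L (smul c v) = conjg c * blinfun_apply L v}"

definition smul_functional ::
  "'k::real_or_complex \<Rightarrow> ('v::banach \<Rightarrow>\<^sub>L 'k) \<Rightarrow> ('v \<Rightarrow>\<^sub>L 'k)" where
  "smul_functional c L = blinfun_mult_right c o\<^sub>L L"

lemma smul_functional_apply [simp]:
  "blinfun_apply (smul_functional c L) v = c * blinfun_apply L v"
  by (simp add: smul_functional_def)

definition weakly_converges ::
  "('k::real_or_complex \<Rightarrow> 'v::banach \<Rightarrow> 'v) \<Rightarrow> (nat \<Rightarrow> 'v) \<Rightarrow> 'v \<Rightarrow> bool" where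
  "weakly_converges smul u l \<longleftrightarrow>
     (\<forall>L\<in>antidual smul. (\<lambda>n. blinfun_apply L (u n)) \<longlonglongrightarrow> blinfun_apply L l)"

definition essentially_coercive ::
  "('k::real_or_complex \<Rightarrow> 'v::banach \<Rightarrow> 'v) \<Rightarrow> ('v \<Rightarrow> 'v \<Rightarrow> 'k) \<Rightarrow> bool" where
  "essentially_coercive smul a \<longleftrightarrow>
     (\<forall>u. weakly_converges smul u 0 \<and> (\<lambda>n. a (u n) (u n)) \<longlonglongrightarrow> 0
        \<longrightarrow> (\<lambda>n. norm (u n)) \<longlonglongrightarrow> 0)"

definition compact_operator ::
  "('k::real_or_complex \<Rightarrow> 'v::real_normed_vector \<Rightarrow> 'v) \<Rightarrow>
   ('k \<Rightarrow> 'w::real_normed_vector \<Rightarrow> 'w) \<Rightarrow> ('v \<Rightarrow> 'w) \<Rightarrow> bool" where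
  "compact_operator smulV smulW T \<longleftrightarrow>
     Vector_Spaces.linear smulV smulW T \<and> compact (closure (T ` cball 0 1))"

definition orthogonal_projection ::
  "('k::real_or_complex \<Rightarrow> 'v::banach \<Rightarrow> 'v) \<Rightarrow> ('v \<Rightarrow> 'v \<Rightarrow> 'k) \<Rightarrow> ('v \<Rightarrow> 'v) \<Rightarrow> bool" where
  "orthogonal_projection smul ip P \<longleftrightarrow>
     Vector_Spaces.linear smul smul P \<and> bounded_linear P \<and>
     P \<circ> P = P \<and> (\<forall>u v. ip (P u) v = ip u (P v))"

definition finite_rank ::
  "('k::real_or_complex \<Rightarrow> 'v::banach \<Rightarrow> 'v) \<Rightarrow> ('v \<Rightarrow> 'v) \<Rightarrow> bool" where
  "finite_rank smul T \<longleftrightarrow> (\<exists>B. finite B \<and> range T \<subseteq> module.span smul B)"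

(* The existence, on the given type 'h, of a Hilbert space H over K and of a compact operator
   J from V to H with |a(u,u)| + |Ju|^2 >= alpha |u|^2.  HOL cannot quantify over the
   type carrying H inside a formula, hence the explicit type argument.  An equivalence with
   "there is a Hilbert space H such that ..." splits into the existence of H on one
   particular type and the converse implication for an arbitrary type 'h. *)

definition coercive_modulo_compact ::
  "'h::banach itself \<Rightarrow> ('k::real_or_complex \<Rightarrow> 'v::banach \<Rightarrow> 'v) \<Rightarrow> ('v \<Rightarrow> 'v \<Rightarrow> 'k) \<Rightarrow> bool"
  where
  "coercive_modulo_compact (H :: 'h itself) smul a \<longleftrightarrow>
     (\<exists>(smulH :: 'k \<Rightarrow> 'h \<Rightarrow> 'h) ipH (J :: 'v \<Rightarrow> 'h) \<alpha>.
        hilbert_space smulH ipH \<and> compact_operator smul smulH J \<and> \<alpha> > 0 \<and>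
        (\<forall>u. norm (a u u) + (norm (J u))\<^sup>2 \<ge> \<alpha> * (norm u)\<^sup>2))"

end

theory Submission
  imports Defs
begin

text \<open>
  Each of (ii), (iii) and (iv) bounds \<open>\<parallel>u\<parallel>\<^sup>2\<close> from above by \<open>\<bar>a(u,u)\<bar>\<close> plus a compact perturbation
  \<open>g(u)\<close>, where \<open>g(u)\<close> is \<open>\<parallel>Pu\<parallel>\<^sup>2\<close>, \<open>\<parallel>Ju\<parallel>\<^sup>2\<close> or \<open>\<bar>\<langle>Ku,u\<rangle>\<bar>\<close>.

  Such a bound implies essential coercivity. If \<open>u\<^sub>n\<close> is weakly null with \<open>a(u\<^sub>n,u\<^sub>n) \<longlonglongrightarrow> 0\<close> but
  \<open>\<parallel>u\<^sub>n\<parallel>\<close> does not tend to \<open>0\<close>, a subsequence stays away from \<open>0\<close>, and dividing it by its norms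
  yields \<^emph>\<open>unit\<close> vectors that are still weakly null with \<open>a\<close> still tending to \<open>0\<close> on the diagonal.
  Normalizing also makes the sequence bounded without an appeal to the uniform boundedness
  principle. A compact operator maps a bounded weakly null sequence to a norm null
  one, hence \<open>g \<longlonglongrightarrow> 0\<close> along the unit vectors, and the bound forces \<open>\<alpha> \<le> 0\<close>. This is
  \<open>essentially_coerciveI\<close> together with \<open>compact_operator_weakly_null\<close>.

  Conversely let \<open>a\<close> be essentially coercive and let \<open>d\<^sub>0, d\<^sub>1, \<dots>\<close> be dense. Let \<open>P\<^sub>n\<close> be an
  orthogonal projection of finite rank that fixes \<open>d\<^sub>0, \<dots>, d\<^sub>n\<close> (\<open>ex_projection_fixing\<close>). If no
  \<open>P\<^sub>n\<close> satisfied (ii) with constant \<open>1/(n+1)\<close>, there would be unit vectors \<open>v\<^sub>n\<close> with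
  \<open>a(v\<^sub>n,v\<^sub>n) \<longlonglongrightarrow> 0\<close> and \<open>P\<^sub>n v\<^sub>n \<longlonglongrightarrow> 0\<close>. For \<open>n \<ge> k\<close> we have \<open>(d\<^sub>k, v\<^sub>n) = (P\<^sub>n d\<^sub>k, v\<^sub>n) = (d\<^sub>k, P\<^sub>n v\<^sub>n)\<close>,
  which tends to \<open>0\<close>. By density and the Riesz representation theorem \<open>v\<^sub>n\<close> is weakly null,
  which contradicts essential coercivity.

  Finally (ii) gives (iii) with \<open>J = P\<close>, because operators of finite rank are compact, and (iv) with
  \<open>\<langle>Ku,v\<rangle> = (Pu,v)\<close>, because \<open>(Pu,u) = \<parallel>Pu\<parallel>\<^sup>2\<close>.
\<close>

section \<open>Scalars, compactness and sequences\<close>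

lemma linear_iff_additive_homogeneous:
  "Vector_Spaces.linear s1 s2 f \<longleftrightarrow> vector_space s1 \<and> vector_space s2 \<and>
     (\<forall>x y. f (x + y) = f x + f y) \<and> (\<forall>c x. f (s1 c x) = s2 c (f x))"
  unfolding Vector_Spaces.linear_def module_hom_def module_hom_axioms_def
  by (auto simp: module_iff_vector_space)

lemma conjg_of_real [simp]: "conjg (of_real r) = (of_real r :: 'k::real_or_complex)"
proof (cases "r = 0")
  case True
  then show ?thesis using conjg_add[of "0::'k" 0] by simp
next
  case False
  have "of_real r * conjg (of_real r) = (of_real r * of_real r :: 'k)"
    using mult_conjg[of "of_real r :: 'k"] by (simp add: power2_eq_square flip: of_real_mult)
  with False show ?thesis by simp
qed

lemma conjg_0 [simp]: "conjg (0 :: 'k::real_or_complex) = 0"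
  using conjg_of_real[of 0] by simp

lemma conjg_1 [simp]: "conjg (1 :: 'k::real_or_complex) = 1"
  using conjg_of_real[of 1] by simp

lemma conjg_minus [simp]: "conjg (- x) = - conjg (x :: 'k::real_or_complex)"
  using conjg_add[of x "- x"] by (simp add: eq_neg_iff_add_eq_0 add.commute)

lemma norm_conjg [simp]: "norm (conjg x) = norm (x :: 'k::real_or_complex)"
proof (cases "x = 0")
  case False
  have "norm x * norm (conjg x) = norm x * norm x"
    using arg_cong[OF mult_conjg[of x], of norm]
    by (simp add: norm_mult power2_eq_square del: of_real_power)
  with False show ?thesis by simp
qed simp

lemma bounded_linear_conjg: "bounded_linear (conjg :: 'k::real_or_complex \<Rightarrow> 'k)"
  by (rule bounded_linear_intro[where K = 1])
    (simp_all add: conjg_add conjg_mult scaleR_conv_of_real)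

text \<open>
  The Heine-Borel property holds because \<open>'k\<close> is isometric to \<open>real\<close> or \<open>complex\<close>.
\<close>
lemma compact_cball_scalars: "compact (cball (0::'k::real_or_complex) r)"
proof -
  have transfer: "compact (cball (0::'k) r)"
    if bij: "bij f" and add: "\<And>x y. f (x + y) = f x + f y" and norm: "\<And>x. norm (f x) = norm x"
    for f :: "'k \<Rightarrow> 'b::{real_normed_vector, heine_borel}"
  proof -
    have f_inv: "f (inv f y) = y" for y using bij by (simp add: bij_is_surj surj_f_inv_f)
    have inv_f: "inv f (f x) = x" for x using bij by (simp add: bij_is_inj)
    have inv_add: "inv f (x + y) = inv f x + inv f y" for x y by (metis add f_inv inv_f)
    have inv_norm: "norm (inv f y) = norm y" for y by (metis f_inv norm)
    have inv_diff: "inv f (x - y) = inv f x - inv f y" for x y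
      using inv_add[of "x - y" y] by (simp add: algebra_simps)
    have "continuous_on (cball 0 r) (inv f)"
      unfolding continuous_on_iff
      by (metis dist_norm inv_diff inv_norm)
    then have "compact (inv f ` cball 0 r)" by (intro compact_continuous_image) auto
    moreover have "inv f ` cball 0 r = cball 0 r"
    proof
      show "inv f ` cball 0 r \<subseteq> cball 0 r" by (auto simp: inv_norm)
      show "cball 0 r \<subseteq> inv f ` cball 0 r"
        by (metis inv_f image_eqI mem_cball_0 norm subsetI)
    qed
    ultimately show ?thesis by simp
  qed
  show ?thesis
    by (rule real_or_complex_cases[where 'k = 'k]) (metis transfer)+
qed

lemma compact_closure_subset:
  fixes S :: "'a::metric_space set"
  assumes "S \<subseteq> C" and "compact C"
  shows "compact (closure S)"
proof -
  have "closure S \<subseteq> C" using assms by (intro closure_minimal compact_imp_closed)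
  then show ?thesis using compact_Int_closed[OF assms(2) closed_closure, of S]
    by (simp add: Int_absorb1)
qed

lemma not_null_subsequence:
  fixes x :: "nat \<Rightarrow> 'a::real_normed_vector"
  assumes "\<not> x \<longlonglongrightarrow> 0"
  obtains e and r :: "nat \<Rightarrow> nat" where "e > 0" "strict_mono r" "\<And>n. norm (x (r n)) \<ge> e"
proof -
  obtain e where e: "e > 0" "\<And>N. \<exists>n\<ge>N. norm (x n) \<ge> e"
    using assms unfolding LIMSEQ_iff by (auto simp: not_less)
  then have "infinite {n. norm (x n) \<ge> e}"
    unfolding infinite_nat_iff_unbounded_le by blast
  then obtain r :: "nat \<Rightarrow> nat" where "strict_mono r" "\<And>n. r n \<in> {n. norm (x n) \<ge> e}"
    using infinite_enumerate by blast
  then show ?thesis using e(1) that by blast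
qed

section \<open>Hilbert space geometry\<close>

context hilbert_space
begin

lemma ip_add_right: "ip u (v + w) = ip u v + ip u w"
  using ip_commute[of u "v + w"] ip_commute[of u v] ip_commute[of u w]
  by (simp add: ip_add_left conjg_add)

lemma ip_smul_right: "ip u (smul c v) = conjg c * ip u v"
  using ip_commute[of u "smul c v"] ip_commute[of u v] by (simp add: ip_smul_left conjg_mult)

lemma smul_neg_1: "smul (- 1) u = - u"
  using smul_of_real[of "-1" u] by simp

lemma ip_minus_left: "ip (- u) v = - ip u v"
  using ip_smul_left[of "-1" u v] by (simp add: smul_neg_1)

lemma ip_minus_right: "ip u (- v) = - ip u v"
  using ip_smul_right[of u "-1" v] by (simp add: smul_neg_1)

lemma ip_diff_left: "ip (u - w) v = ip u v - ip w v"
  using ip_add_left[of u "- w" v] by (simp add: ip_minus_left)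

lemma ip_diff_right: "ip u (v - w) = ip u v - ip u w"
  using ip_add_right[of u v "- w"] by (simp add: ip_minus_right)

lemmas ip_expand = ip_add_left ip_add_right ip_diff_left ip_diff_right ip_smul_left ip_smul_right

lemma ip_zero_left [simp]: "ip 0 v = 0"
  using ip_diff_left[of 0 0 v] by simp

lemma ip_zero_right [simp]: "ip u 0 = 0"
  using ip_diff_right[of u 0 0] by simp

lemma ip_self_eq_0_iff [simp]: "ip u u = 0 \<longleftrightarrow> u = 0"
  by (simp add: ip_self)

lemma ip_scaleR_left: "ip (r *\<^sub>R u) v = r *\<^sub>R ip u v"
  by (simp add: ip_smul_left scaleR_conv_of_real flip: smul_of_real)

lemma ip_scaleR_right: "ip u (r *\<^sub>R v) = r *\<^sub>R ip u v"
  by (simp add: ip_smul_right scaleR_conv_of_real flip: smul_of_real)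

lemma norm_smul: "norm (smul c u) = norm c * norm u"
proof -
  have "(of_real ((norm (smul c u))\<^sup>2) :: 'k) = (c * conjg c) * ip u u"
    unfolding ip_self[symmetric] by (simp add: ip_smul_left ip_smul_right)
  also have "\<dots> = of_real ((norm c * norm u)\<^sup>2)"
    unfolding mult_conjg ip_self by (simp only: of_real_mult power_mult_distrib)
  finally have "(norm (smul c u))\<^sup>2 = (norm c * norm u)\<^sup>2" by (simp only: of_real_eq_iff)
  then show ?thesis by (rule power2_eq_imp_eq) simp_all
qed

text \<open>
  Pythagoras for the component of \<open>u\<close> orthogonal to \<open>v\<close>. The nonnegativity of the left-hand side is
  the Cauchy-Schwarz inequality, and the same identity turns minimality of a norm into orthogonality.
\<close>
lemma norm_minus_component:
  assumes "v \<noteq> 0"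
  shows "(norm (u - smul (ip u v / of_real ((norm v)\<^sup>2)) v))\<^sup>2
    = (norm u)\<^sup>2 - (norm (ip u v))\<^sup>2 / (norm v)\<^sup>2"
proof -
  let ?n = "of_real ((norm v)\<^sup>2) :: 'k"
  let ?c = "ip u v / ?n"
  have n: "?n \<noteq> 0" "ip v v = ?n" using assms by (simp_all add: ip_self)
  have "conjg (?c * ?n) = conjg ?c * ?n" by (simp only: conjg_mult conjg_of_real)
  then have c: "conjg ?c = conjg (ip u v) / ?n" using n(1) by (simp add: field_simps)
  have "(of_real ((norm (u - smul ?c v))\<^sup>2) :: 'k) = ip (u - smul ?c v) (u - smul ?c v)"
    by (simp only: ip_self)
  also have "\<dots> = ip u u - (ip u v * conjg (ip u v)) / ?n"
    unfolding ip_expand c n(2) ip_commute[of v u] using n(1)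
    by (simp add: field_simps del: of_real_power)
  also have "\<dots> = of_real ((norm u)\<^sup>2 - (norm (ip u v))\<^sup>2 / (norm v)\<^sup>2)"
    unfolding mult_conjg ip_self by (simp only: of_real_diff of_real_divide)
  finally show ?thesis by (simp only: of_real_eq_iff)
qed

lemma Cauchy_Schwarz: "norm (ip u v) \<le> norm u * norm v"
proof (cases "v = 0")
  case False
  have "0 \<le> (norm u)\<^sup>2 - (norm (ip u v))\<^sup>2 / (norm v)\<^sup>2"
    using norm_minus_component[OF False, of u] by (metis zero_le_power2)
  then have "(norm (ip u v))\<^sup>2 \<le> (norm u * norm v)\<^sup>2"
    using False by (simp add: field_simps)
  then show ?thesis by (rule power2_le_imp_le) simp
qed simp

lemma bounded_linear_ip_right: "bounded_linear (ip u)"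
  by (rule bounded_linear_intro[where K = "norm u"])
    (simp_all add: ip_add_right ip_scaleR_right Cauchy_Schwarz mult.commute[of "norm u"],
      metis Cauchy_Schwarz mult.commute)

lemma parallelogram:
  fixes u v :: 'v
  shows "(norm (u + v))\<^sup>2 + (norm (u - v))\<^sup>2 = 2 * (norm u)\<^sup>2 + 2 * (norm v)\<^sup>2"
proof -
  have "(of_real ((norm (u + v))\<^sup>2 + (norm (u - v))\<^sup>2) :: 'k)
      = ip (u + v) (u + v) + ip (u - v) (u - v)"
    by (simp only: ip_self of_real_add)
  also have "\<dots> = 2 * ip u u + 2 * ip v v" by (simp add: ip_expand algebra_simps)
  also have "\<dots> = of_real (2 * (norm u)\<^sup>2 + 2 * (norm v)\<^sup>2)"
    by (simp only: ip_self of_real_add of_real_mult of_real_numeral)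
  finally show ?thesis by (simp only: of_real_eq_iff)
qed

text \<open>
  By the parallelogram law, two points of \<open>S\<close> whose norms are close to the infimum are close to each
  other, since their midpoint cannot have smaller norm. A minimizing sequence is therefore Cauchy.
\<close>
lemma min_norm_in_midpoint_closed_set:
  fixes S :: "'v set"
  assumes "closed S" and "S \<noteq> {}"
    and midpoint: "\<And>u v. u \<in> S \<Longrightarrow> v \<in> S \<Longrightarrow> (1/2) *\<^sub>R (u + v) \<in> S"
  obtains w where "w \<in> S" "\<And>v. v \<in> S \<Longrightarrow> norm w \<le> norm v"
proof -
  define d where "d = Inf (norm ` S)"
  have bdd: "bdd_below (norm ` S)" by (rule bdd_belowI2[of _ 0]) simp
  have d_le: "d \<le> norm v" if "v \<in> S" for v
    unfolding d_def by (rule cInf_lower[OF _ bdd]) (use that in auto)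
  have d0: "0 \<le> d" unfolding d_def by (rule cInf_greatest) (use assms(2) in auto)
  have "\<exists>v\<in>S. norm v < d + 1 / real (Suc n)" for n
  proof -
    have "Inf (norm ` S) < d + 1 / real (Suc n)" by (simp add: d_def)
    from cInf_lessD[OF _ this] show ?thesis using assms(2) by auto
  qed
  then obtain x where x: "\<And>n. x n \<in> S" "\<And>n. norm (x n) < d + 1 / real (Suc n)" by metis
  have lim: "(\<lambda>n. norm (x n)) \<longlonglongrightarrow> d"
  proof (rule tendsto_sandwich[OF _ _ tendsto_const])
    show "\<forall>\<^sub>F n in sequentially. d \<le> norm (x n)" using d_le x(1) by simp
    show "\<forall>\<^sub>F n in sequentially. norm (x n) \<le> d + 1 / real (Suc n)"
      using x(2) by (intro always_eventually allI less_imp_le)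
    show "(\<lambda>n. d + 1 / real (Suc n)) \<longlonglongrightarrow> d"
      using tendsto_add[OF tendsto_const lim_1_over_n[THEN LIMSEQ_Suc], of d] by simp
  qed
  have diff: "(norm (x m - x n))\<^sup>2 \<le> 2 * (norm (x m))\<^sup>2 + 2 * (norm (x n))\<^sup>2 - 4 * d\<^sup>2" for m n
  proof -
    have "d \<le> norm ((1/2) *\<^sub>R (x m + x n))" by (intro d_le midpoint x)
    then have "2 * d \<le> norm (x m + x n)" by simp
    then have "(2 * d)\<^sup>2 \<le> (norm (x m + x n))\<^sup>2" using d0 by (intro power_mono) auto
    then show ?thesis using parallelogram[of "x m" "x n"] by (simp add: power_mult_distrib)
  qed
  have "Cauchy x"
  proof (rule metric_CauchyI)
    fix e :: real assume "e > 0"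
    have "(\<lambda>n. (norm (x n))\<^sup>2) \<longlonglongrightarrow> d\<^sup>2" by (intro tendsto_power lim)
    then have "\<forall>\<^sub>F n in sequentially. (norm (x n))\<^sup>2 < d\<^sup>2 + e\<^sup>2 / 4"
      by (rule order_tendstoD) (use \<open>e > 0\<close> in simp)
    then obtain N where N: "\<And>n. n \<ge> N \<Longrightarrow> (norm (x n))\<^sup>2 < d\<^sup>2 + e\<^sup>2 / 4"
      by (auto simp: eventually_sequentially)
    have "dist (x m) (x n) < e" if "m \<ge> N" "n \<ge> N" for m n
    proof -
      have "(norm (x m - x n))\<^sup>2 < e\<^sup>2" using diff[of m n] N[OF that(1)] N[OF that(2)] by linarith
      then show ?thesis
        using \<open>e > 0\<close> by (simp add: dist_norm power2_less_imp_less)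
    qed
    then show "\<exists>N. \<forall>m\<ge>N. \<forall>n\<ge>N. dist (x m) (x n) < e" by blast
  qed
  then obtain w where w: "x \<longlonglongrightarrow> w" using Cauchy_convergent unfolding convergent_def by blast
  show thesis
  proof
    show "w \<in> S" using closed_sequentially[OF assms(1)] x(1) w by blast
    have "norm w = d" using LIMSEQ_unique[OF tendsto_norm[OF w] lim] .
    then show "norm w \<le> norm v" if "v \<in> S" for v using d_le that by simp
  qed
qed

lemma min_norm_imp_orthogonal:
  assumes "\<And>c. norm w \<le> norm (w - smul c v)"
  shows "ip w v = 0"
proof (cases "v = 0")
  case False
  have "(norm w)\<^sup>2 \<le> (norm w)\<^sup>2 - (norm (ip w v))\<^sup>2 / (norm v)\<^sup>2"
    unfolding norm_minus_component[OF False, symmetric] by (intro power_mono assms) simp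
  then show ?thesis using False by (simp add: field_simps)
qed simp

text \<open>
  The point \<open>w\<close> of least norm on the hyperplane \<open>L = 1\<close> is orthogonal to the kernel of \<open>L\<close>, and
  every \<open>v\<close> is the sum of a multiple of \<open>w\<close> and a vector in that kernel.
\<close>
lemma Riesz_representation:
  assumes "L \<in> antidual smul"
  obtains w where "\<And>v. blinfun_apply L v = ip w v"
proof (cases "L = 0")
  case True
  then show ?thesis using that[of 0] by simp
next
  case False
  have L: "L (smul c v) = conjg c * L v" for c v using assms by (simp add: antidual_def)
  define S where "S = {v. L v = 1}"
  obtain x where x: "L x \<noteq> 0" using False by (metis blinfun_eqI zero_blinfun.rep_eq)
  have "closed S" unfolding S_def
    by (intro closed_Collect_eq continuous_intros)
  moreover have "smul (conjg (1 / L x)) x \<in> S" using x by (simp add: S_def L conjg_conjg)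
  then have "S \<noteq> {}" by blast
  moreover have "(1/2) *\<^sub>R (u + v) \<in> S" if "u \<in> S" "v \<in> S" for u v
    using that by (simp add: S_def blinfun.bilinear_simps scaleR_conv_of_real)
  ultimately obtain w where w: "w \<in> S" "\<And>v. v \<in> S \<Longrightarrow> norm w \<le> norm v"
    using min_norm_in_midpoint_closed_set by blast
  have Lw: "L w = 1" using w(1) by (simp add: S_def)
  then have w0: "w \<noteq> 0" by (auto simp: blinfun.zero_right)
  have kernel: "ip w v = 0" if "L v = 0" for v
    by (rule min_norm_imp_orthogonal, rule w(2))
      (simp add: S_def Lw L that blinfun.bilinear_simps)
  have "L v * ip w w = ip w v" for v
  proof -
    have "ip w (v - smul (conjg (L v)) w) = 0"
      by (rule kernel) (simp add: L Lw conjg_conjg blinfun.bilinear_simps)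
    then show ?thesis by (simp add: ip_diff_right ip_smul_right conjg_conjg)
  qed
  then have "L v = ip (smul (1 / ip w w) w) v" for v
    using w0 by (simp add: ip_smul_left field_simps)
  then show ?thesis using that by blast
qed


section \<open>Compact operators and weakly null sequences\<close>

lemma weakly_null_antilinear:
  assumes "weakly_converges smul u 0" and f: "bounded_linear f"
    and "\<And>c v. f (smul c v) = conjg c * f v"
  shows "(\<lambda>n. f (u n)) \<longlonglongrightarrow> 0"
proof -
  have "Blinfun f \<in> antidual smul"
    using assms(3) by (simp add: antidual_def bounded_linear_Blinfun_apply[OF f])
  then have "(\<lambda>n. blinfun_apply (Blinfun f) (u n)) \<longlonglongrightarrow> blinfun_apply (Blinfun f) 0"
    using assms(1) unfolding weakly_converges_def by blast
  then show ?thesis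
    by (simp add: bounded_linear_Blinfun_apply[OF f] linear_simps(3)[OF f])
qed

lemma compact_operator_imp_bounded_linear:
  assumes T: "compact_operator smul smulW T"
    and real: "\<And>r w. smulW (of_real r) w = r *\<^sub>R w"
  shows "bounded_linear T"
proof -
  have add: "T (x + y) = T x + T y" and scale: "T (smul c x) = smulW c (T x)" for x y c
    using T by (auto simp: compact_operator_def linear_iff_additive_homogeneous)
  have scaleR: "T (r *\<^sub>R x) = r *\<^sub>R T x" for r x
    using scale[of "of_real r" x] by (simp add: smul_of_real real)
  have "bounded (T ` cball 0 1)"
    using T by (meson bounded_subset closure_subset compact_imp_bounded compact_operator_def)
  then obtain M where "\<forall>x\<in>cball 0 1. norm (T x) \<le> M"
    by (auto simp: bounded_iff)
  then have M: "norm (T x) \<le> M" if "norm x \<le> 1" for x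
    using that by simp
  show ?thesis
  proof (rule bounded_linear_intro[OF add scaleR])
    fix x
    show "norm (T x) \<le> norm x * M"
    proof (cases "x = 0")
      case True
      then show ?thesis using scaleR[of 0 0] by simp
    next
      case False
      then have "norm (T ((1 / norm x) *\<^sub>R x)) \<le> M" by (intro M) simp
      then show ?thesis using False by (simp add: scaleR field_simps)
    qed
  qed
qed

text \<open>
  If \<open>T u\<^sub>n\<close> stayed away from \<open>0\<close> along a subsequence, compactness would give a limit point \<open>y \<noteq> 0\<close>. A
  continuous antilinear functional \<open>f\<close> on the target with \<open>f y \<noteq> 0\<close> is excluded, because \<open>f \<circ> T\<close>
  tests weak convergence. The existence of such functionals is a hypothesis so that the lemma
  covers both Hilbert spaces and the antidual as targets.
\<close>
lemma compact_operator_weakly_null: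
  assumes T: "compact_operator smul smulW T"
    and real: "\<And>r w. smulW (of_real r) w = r *\<^sub>R w"
    and separating: "\<And>y. y \<noteq> 0 \<Longrightarrow>
      \<exists>f. bounded_linear f \<and> (\<forall>c w. f (smulW c w) = conjg c * f w) \<and> f y \<noteq> (0 :: 'k)"
    and u: "weakly_converges smul u 0" "\<And>n. norm (u n) \<le> 1"
  shows "(\<lambda>n. T (u n)) \<longlonglongrightarrow> 0"
proof (rule ccontr)
  assume "\<not> ?thesis"
  then obtain e and r :: "nat \<Rightarrow> nat" where e: "e > 0" and r: "strict_mono r" "\<And>n. norm (T (u (r n))) \<ge> e"
    by (rule not_null_subsequence) blast
  have "T (u (r n)) \<in> closure (T ` cball 0 1)" for n
    using u(2) by (intro subsetD[OF closure_subset]) simp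
  moreover have "seq_compact (closure (T ` cball 0 1))"
    using T by (simp add: compact_operator_def compact_imp_seq_compact)
  ultimately obtain y s where s: "strict_mono s" and y: "(\<lambda>n. T (u (r (s n)))) \<longlonglongrightarrow> y"
    by (auto elim!: seq_compactE[where f = "\<lambda>n. T (u (r n))"] simp: o_def)
  have "e \<le> norm y"
    by (rule LIMSEQ_le_const[OF tendsto_norm[OF y]]) (use r(2) in blast)
  then have "y \<noteq> 0" using e by auto
  then obtain f where f: "bounded_linear f" "\<And>c w. f (smulW c w) = conjg c * f w" "f y \<noteq> (0 :: 'k)"
    using separating by blast
  have "(\<lambda>n. f (T (u n))) \<longlonglongrightarrow> 0"
  proof (rule weakly_null_antilinear[OF u(1)])
    show "bounded_linear (\<lambda>x. f (T x))"
      using f(1) compact_operator_imp_bounded_linear[OF T real] by (rule bounded_linear_compose)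
    show "f (T (smul c v)) = conjg c * f (T v)" for c v
      using T by (simp add: compact_operator_def linear_iff_additive_homogeneous f(2))
  qed
  then have "(\<lambda>n. f (T (u (r (s n))))) \<longlonglongrightarrow> 0"
    using LIMSEQ_subseq_LIMSEQ[of _ 0 "r \<circ> s"] strict_mono_o[OF r(1) s] by (force simp: o_def)
  moreover have "(\<lambda>n. f (T (u (r (s n))))) \<longlonglongrightarrow> f y"
    using f(1) y by (rule bounded_linear.tendsto)
  ultimately show False using f(3) LIMSEQ_unique by blast
qed

section \<open>Coercivity modulo a compact perturbation implies essential coercivity\<close>

lemma sesquilinear_scaleR_diag:
  assumes "sesquilinear_form smul a"
  shows "a (r *\<^sub>R u) (r *\<^sub>R u) = r\<^sup>2 *\<^sub>R a u u"
  using assms unfolding sesquilinear_form_def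
  by (simp add: scaleR_conv_of_real power2_eq_square flip: smul_of_real)

text \<open>
  The function \<open>g\<close> only has to vanish along weakly null sequences of unit vectors: a weakly null
  sequence whose norms do not tend to \<open>0\<close> can be normalized along a subsequence.
\<close>
lemma essentially_coerciveI:
  assumes a: "sesquilinear_form smul a" and "\<alpha> > 0"
    and lower: "\<And>u. norm (a u u) + g u \<ge> \<alpha> * (norm u)\<^sup>2"
    and g: "\<And>u. weakly_converges smul u 0 \<Longrightarrow> (\<And>n. norm (u n) = 1) \<Longrightarrow> (\<lambda>n. g (u n)) \<longlonglongrightarrow> 0"
  shows "essentially_coercive smul a"
  unfolding essentially_coercive_def
proof (intro allI impI, elim conjE, rule ccontr)
  fix u
  assume u: "weakly_converges smul u 0" "(\<lambda>n. a (u n) (u n)) \<longlonglongrightarrow> 0"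
    and "\<not> (\<lambda>n. norm (u n)) \<longlonglongrightarrow> 0"
  then have "\<not> u \<longlonglongrightarrow> 0" by (simp add: tendsto_norm_zero_iff)
  then obtain e and r :: "nat \<Rightarrow> nat" where e: "e > 0" and r: "strict_mono r" "\<And>n. norm (u (r n)) \<ge> e"
    by (rule not_null_subsequence) blast
  define v where "v n = (1 / norm (u (r n))) *\<^sub>R u (r n)" for n
  have pos: "0 < norm (u (r n))" for n using e r(2)[of n] by linarith
  have le: "1 / norm (u (r n)) \<le> 1 / e" for n using e r(2)[of n] by (simp add: frac_le)
  have norm_v: "norm (v n) = 1" for n using pos[of n] by (simp add: v_def)
  have "weakly_converges smul v 0"
    unfolding weakly_converges_def
  proof
    fix L assume "L \<in> antidual smul"
    then have "(\<lambda>n. blinfun_apply L (u n)) \<longlonglongrightarrow> 0"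
      using u(1) by (auto simp: weakly_converges_def)
    from tendsto_norm_zero[OF LIMSEQ_subseq_LIMSEQ[OF this r(1)]]
    have "(\<lambda>n. (1 / e) * norm (blinfun_apply L (u (r n)))) \<longlonglongrightarrow> 0"
      unfolding o_def by (rule tendsto_mult_right_zero)
    moreover have "\<forall>\<^sub>F n in sequentially. norm (blinfun_apply L (v n))
        \<le> (1 / e) * norm (blinfun_apply L (u (r n)))"
    proof (rule always_eventually, rule allI)
      show "norm (blinfun_apply L (v n)) \<le> (1 / e) * norm (blinfun_apply L (u (r n)))" for n
        using mult_right_mono[OF le[of n], of "norm (blinfun_apply L (u (r n)))"]
        by (simp add: v_def blinfun.scaleR_right)
    qed
    ultimately have "(\<lambda>n. blinfun_apply L (v n)) \<longlonglongrightarrow> 0"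
      by (rule Lim_null_comparison[rotated])
    then show "(\<lambda>n. blinfun_apply L (v n)) \<longlonglongrightarrow> blinfun_apply L 0"
      by (simp add: blinfun.zero_right)
  qed
  then have "(\<lambda>n. g (v n)) \<longlonglongrightarrow> 0" using norm_v by (rule g)
  moreover have "(\<lambda>n. norm (a (v n) (v n))) \<longlonglongrightarrow> 0"
  proof (rule tendsto_norm_zero, rule Lim_null_comparison)
    show "(\<lambda>n. (1 / e)\<^sup>2 * norm (a (u (r n)) (u (r n)))) \<longlonglongrightarrow> 0"
      using tendsto_mult_right_zero[OF tendsto_norm_zero[OF LIMSEQ_subseq_LIMSEQ[OF u(2) r(1)]]]
      by (simp add: o_def)
    have "norm (a (v n) (v n)) \<le> (1 / e)\<^sup>2 * norm (a (u (r n)) (u (r n)))" for n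
      unfolding v_def sesquilinear_scaleR_diag[OF a] norm_scaleR
      using le[of n] by (intro mult_right_mono) (auto simp del: power_divide intro!: power_mono)
    then show "\<forall>\<^sub>F n in sequentially.
        norm (a (v n) (v n)) \<le> (1 / e)\<^sup>2 * norm (a (u (r n)) (u (r n)))" by simp
  qed
  ultimately have "(\<lambda>n. norm (a (v n) (v n)) + g (v n)) \<longlonglongrightarrow> 0"
    using tendsto_add by fastforce
  moreover have "\<alpha> \<le> norm (a (v n) (v n)) + g (v n)" for n
    using lower[of "v n"] by (simp add: norm_v)
  ultimately have "\<alpha> \<le> 0" by (meson LIMSEQ_le_const)
  then show False using \<open>\<alpha> > 0\<close> by simp
qed

lemma coercive_modulo_compact_imp_essentially_coercive:
  assumes "sesquilinear_form smul a" and "coercive_modulo_compact TYPE('h::banach) smul a"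
  shows "essentially_coercive smul a"
proof -
  obtain smulH ipH and J :: "'v \<Rightarrow> 'h" and \<alpha> where H: "hilbert_space smulH ipH"
    and J: "compact_operator smul smulH J" and "\<alpha> > 0"
    and lower: "\<And>u. norm (a u u) + (norm (J u))\<^sup>2 \<ge> \<alpha> * (norm u)\<^sup>2"
    using assms(2) unfolding coercive_modulo_compact_def by blast
  interpret H: hilbert_space smulH ipH by (rule H)
  show ?thesis
  proof (rule essentially_coerciveI[OF assms(1) \<open>\<alpha> > 0\<close> lower])
    fix u assume u: "weakly_converges smul u 0" "\<And>n. norm (u n) = 1"
    have "(\<lambda>n. J (u n)) \<longlonglongrightarrow> 0"
    proof (rule compact_operator_weakly_null[OF J H.smul_of_real _ u(1)])
      show "\<exists>f. bounded_linear f \<and> (\<forall>c w. f (smulH c w) = conjg c * f w) \<and> f y \<noteq> 0"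
        if "y \<noteq> 0" for y
        by (intro exI[of _ "ipH y"])
          (simp add: H.bounded_linear_ip_right H.ip_smul_right that)
    qed (simp add: u(2))
    then show "(\<lambda>n. (norm (J (u n)))\<^sup>2) \<longlonglongrightarrow> 0"
      by (intro tendsto_eq_intros tendsto_norm_zero) auto
  qed
qed

text \<open>
  The evaluations \<open>L \<mapsto> conjg (L v)\<close> are antilinear functionals that separate the points of the
  target of \<open>K\<close>.
\<close>
lemma compact_functional_imp_essentially_coercive:
  assumes "sesquilinear_form smul a" and K: "compact_operator smul smul_functional K" and "\<alpha> > 0"
    and "\<And>u. norm (a u u) + norm (blinfun_apply (K u) u) \<ge> \<alpha> * (norm u)\<^sup>2"
  shows "essentially_coercive smul a"
proof (rule essentially_coerciveI[OF assms(1,3,4)])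
  fix u assume u: "weakly_converges smul u 0" "\<And>n. norm (u n) = 1"
  have "(\<lambda>n. K (u n)) \<longlonglongrightarrow> 0"
  proof (rule compact_operator_weakly_null[OF K _ _ u(1)])
    show "smul_functional (of_real r) L = r *\<^sub>R L" for r and L :: "'v \<Rightarrow>\<^sub>L 'k"
      by (rule blinfun_eqI) (simp add: blinfun.scaleR_left scaleR_conv_of_real)
    show "\<exists>f. bounded_linear f \<and> (\<forall>c w. f (smul_functional c w) = conjg c * f w) \<and> f L \<noteq> 0"
      if L: "L \<noteq> 0" for L :: "'v \<Rightarrow>\<^sub>L 'k"
    proof -
      obtain v where "blinfun_apply L v \<noteq> 0" using L by (metis blinfun_eqI zero_blinfun.rep_eq)
      moreover have "bounded_linear (\<lambda>L :: 'v \<Rightarrow>\<^sub>L 'k. conjg (blinfun_apply L v))"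
        by (rule bounded_linear_compose[OF bounded_linear_conjg]) (rule blinfun.bounded_linear_left)
      ultimately show ?thesis
        by (intro exI[of _ "\<lambda>L. conjg (blinfun_apply L v)"])
          (metis conjg_mult norm_conjg norm_eq_zero smul_functional_apply)
    qed
  qed (simp add: u(2))
  then have K_null: "(\<lambda>n. norm (K (u n))) \<longlonglongrightarrow> 0" by (rule tendsto_norm_zero)
  show "(\<lambda>n. norm (blinfun_apply (K (u n)) (u n))) \<longlonglongrightarrow> 0"
  proof (rule Lim_null_comparison[OF always_eventually K_null], rule allI)
    show "norm (norm (blinfun_apply (K (u n)) (u n))) \<le> norm (K (u n))" for n
      using norm_blinfun[of "K (u n)" "u n"] u(2) by simp
  qed
qed

section \<open>Projections of finite rank\<close>

text \<open>
  One Gram-Schmidt step at a time: if \<open>P\<close> fixes \<open>B\<close> and \<open>w = b - P b\<close> is nonzero, then adding to \<open>P\<close>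
  the projection onto the line through \<open>w\<close> gives an orthogonal projection fixing \<open>b\<close> as well.
  Compactness is carried along, since the new component of the image of the unit ball has
  coefficients in a ball of scalars; it also supplies the boundedness of the projection.
\<close>
lemma ex_projection_fixing:
  assumes "finite B"
  obtains P where "orthogonal_projection smul ip P" "range P \<subseteq> span B" "\<And>b. b \<in> B \<Longrightarrow> P b = b"
    "compact_operator smul smul P"
proof -
  have "\<exists>P. orthogonal_projection smul ip P \<and> range P \<subseteq> span B \<and> (\<forall>b\<in>B. P b = b) \<and>
      compact_operator smul smul P"
    using assms
  proof induction
    case empty
    have "Vector_Spaces.linear smul smul (\<lambda>_. 0)"
      by (simp add: linear_iff_additive_homogeneous vector_space_axioms)
    then show ?case
      by (intro exI[of _ "\<lambda>_. 0"])
        (auto simp: orthogonal_projection_def compact_operator_def o_def image_constant_conv)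
  next
    case (insert b B)
    then obtain P where P: "orthogonal_projection smul ip P" "range P \<subseteq> span B"
      "\<And>x. x \<in> B \<Longrightarrow> P x = x" "compact_operator smul smul P" by blast
    have P_add: "P (x + y) = P x + P y" and P_smul: "P (smul c x) = smul c (P x)"
      and P_idem: "P (P x) = P x" and P_sym: "ip (P x) y = ip x (P y)" for x y c
      using P(1) by (auto simp: orthogonal_projection_def linear_iff_additive_homogeneous fun_eq_iff)
    have P_diff: "P (x - y) = P x - P y" for x y
      using P_add[of "x - y" y] by (simp add: algebra_simps)
    have P_span: "P x \<in> span (insert b B)" for x
      using P(2) span_mono[of B "insert b B"] by blast
    define w where "w = b - P b"
    have Pw: "P w = 0" by (simp add: w_def P_diff P_idem)
    show ?case
    proof (cases "w = 0")
      case True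
      then have "P b = b" by (simp add: w_def)
      then show ?thesis using P P_span by (intro exI[of _ P]) auto
    next
      case False
      define n where "n = ip w w"
      have n: "n \<noteq> 0" "conjg n = n" using False ip_commute[of w w] by (simp_all add: n_def)
      have cn: "conjg (c / n) = conjg c / n" for c
        using conjg_mult[of "c / n" n] n by (simp add: field_simps)
      define Q where "Q x = P x + smul (ip x w / n) w" for x
      have lin: "Vector_Spaces.linear smul smul Q"
        unfolding linear_iff_additive_homogeneous
        by (simp add: Q_def vector_space_axioms P_add P_smul ip_add_left ip_smul_left
            add_divide_distrib scale_left_distrib scale_right_distrib)
      have ip_Pw: "ip (P x) w = 0" for x by (simp add: P_sym Pw)
      have "Q (Q x) = Q x" for x
        using n(1) by (simp add: Q_def P_add P_smul P_idem Pw ip_add_left ip_smul_left ip_Pw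
            flip: n_def)
      moreover have "ip (Q x) y = ip x (Q y)" for x y
        by (simp add: Q_def ip_add_left ip_add_right ip_smul_left ip_smul_right P_sym cn
            flip: ip_commute)
      moreover have compact: "compact_operator smul smul Q"
      proof -
        obtain r where r: "\<And>x. norm x \<le> 1 \<Longrightarrow> norm (ip x w / n) \<le> r"
        proof
          fix x :: 'v assume "norm x \<le> 1"
          then have "norm x * norm w \<le> norm w" by (simp add: mult_left_le_one_le)
          then have "norm (ip x w) \<le> norm w" using Cauchy_Schwarz[of x w] by linarith
          then show "norm (ip x w / n) \<le> norm w / norm n"
            by (simp add: norm_divide divide_right_mono)
        qed
        let ?f = "\<lambda>(x, c). x + smul c w"
        let ?C = "?f ` (closure (P ` cball 0 1) \<times> cball (0::'k) r)"
        have "bounded_linear (\<lambda>c. smul c w)"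
        proof (rule bounded_linear_intro)
          show "smul (x + y) w = smul x w + smul y w" for x y by (rule scale_left_distrib)
          show "smul (s *\<^sub>R x) w = s *\<^sub>R smul x w" for s x
            by (simp add: scaleR_conv_of_real flip: smul_of_real)
          show "norm (smul x w) \<le> norm x * norm w" for x by (simp add: norm_smul)
        qed
        from bounded_linear.continuous_on[OF this continuous_on_snd[OF continuous_on_id]]
        have "continuous_on S ?f" for S
          unfolding case_prod_beta
          by (rule continuous_on_add[OF continuous_on_fst[OF continuous_on_id]])
        moreover have "compact (closure (P ` cball 0 1) \<times> cball (0::'k) r)"
          using P(4) compact_cball_scalars by (intro compact_Times) (simp_all add: compact_operator_def)
        ultimately have "compact ?C" by (rule compact_continuous_image)
        moreover have "Q ` cball 0 1 \<subseteq> ?C"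
        proof
          fix y assume "y \<in> Q ` cball 0 1"
          then obtain x where x: "norm x \<le> 1" "y = ?f (P x, ip x w / n)" by (auto simp: Q_def)
          have "P x \<in> closure (P ` cball 0 1)"
            using x(1) by (intro subsetD[OF closure_subset]) simp
          then have "(P x, ip x w / n) \<in> closure (P ` cball 0 1) \<times> cball 0 r" using x(1) r by simp
          then show "y \<in> ?C" unfolding x(2) by (rule imageI)
        qed
        ultimately show ?thesis
          using lin by (simp add: compact_operator_def compact_closure_subset)
      qed
      ultimately have "orthogonal_projection smul ip Q"
        using lin compact_operator_imp_bounded_linear[OF compact smul_of_real]
        by (auto simp: orthogonal_projection_def fun_eq_iff)
      moreover have "b \<in> span (insert b B)" by (simp add: span_base)
      then have "range Q \<subseteq> span (insert b B)"
        using P_span by (auto simp: Q_def w_def intro!: span_add span_scale span_diff)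
      moreover have "Q x = x" if "x \<in> insert b B" for x
      proof (cases "x = b")
        case True
        have "ip b w = ip w w" using ip_Pw[of b] by (simp add: w_def ip_diff_left)
        then have "ip b w / n = 1" using n(1) by (simp add: n_def)
        then show ?thesis using True by (simp add: Q_def w_def)
      next
        case False
        then have "P x = x" using P(3) that by simp
        then show ?thesis using ip_Pw[of x] by (simp add: Q_def)
      qed
      ultimately show ?thesis using compact by blast
    qed
  qed
  then show ?thesis using that by blast
qed

text \<open>
  If a projection \<open>P\<close> fixes the finite spanning set of a space containing the range of \<open>T\<close>, then
  \<open>T = P \<circ> T\<close>, and \<open>P\<close> is compact if it comes from \<open>ex_projection_fixing\<close>.
\<close>
lemma finite_rank_imp_compact:
  assumes lin: "Vector_Spaces.linear smul smul T" and T: "bounded_linear T" and "finite_rank smul T"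
  shows "compact_operator smul smul T"
proof -
  obtain B where B: "finite B" "range T \<subseteq> span B" using assms(3) by (auto simp: finite_rank_def)
  obtain P where P: "\<And>b. b \<in> B \<Longrightarrow> P b = b" "compact_operator smul smul P"
    by (rule ex_projection_fixing[OF B(1)]) blast
  have P_add: "P (x + y) = P x + P y" and P_smul: "P (smul c x) = smul c (P x)" for x y c
    using P(2) by (auto simp: compact_operator_def linear_iff_additive_homogeneous)
  have P_span: "P x = x" if "x \<in> span B" for x
    using that
  proof (induction rule: span_induct_alt)
    case base
    then show ?case using P_smul[of 0 0] by simp
  next
    case (step c x y)
    then show ?case by (simp add: P_add P_smul P(1))
  qed
  obtain M where M: "M > 0" "\<And>x. norm (T x) \<le> norm x * M" using bounded_linear.pos_bounded[OF T] by blast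
  have "T ` cball 0 1 \<subseteq> (\<lambda>y. M *\<^sub>R y) ` closure (P ` cball 0 1)"
  proof
    fix y assume "y \<in> T ` cball 0 1"
    then obtain x where x: "norm x \<le> 1" "y = T x" by auto
    have "norm x * M \<le> M" using x(1) M(1) by simp
    then have "norm y \<le> M" using M(2)[of x] x(2) by simp
    then have "(1 / M) *\<^sub>R y \<in> cball 0 1" using M(1) by (simp add: field_simps)
    then have "P ((1 / M) *\<^sub>R y) \<in> closure (P ` cball 0 1)" by (intro subsetD[OF closure_subset]) simp
    moreover have "P y = y" using B(2) x(2) by (intro P_span) auto
    then have "P ((1 / M) *\<^sub>R y) = (1 / M) *\<^sub>R y"
      using P_smul[of "of_real (1 / M)" y] unfolding smul_of_real by simp
    ultimately show "y \<in> (\<lambda>y. M *\<^sub>R y) ` closure (P ` cball 0 1)"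
      using M(1) by (intro image_eqI[where x = "(1 / M) *\<^sub>R y"]) auto
  qed
  moreover have "compact ((\<lambda>y. M *\<^sub>R y) ` closure (P ` cball 0 1))"
    using P(2) by (intro compact_scaling) (simp add: compact_operator_def)
  ultimately show ?thesis
    using lin by (simp add: compact_operator_def compact_closure_subset)
qed

text \<open>
  Composing with the Riesz map \<open>w \<mapsto> (w, \<cdot>)\<close>, which is bounded and linear, preserves compactness.
\<close>
lemma compact_operator_Riesz_map:
  assumes T: "compact_operator smul smul T"
  shows "compact_operator smul smul_functional (\<lambda>u. Blinfun (ip (T u)))"
proof -
  have riesz_apply: "blinfun_apply (Blinfun (ip w)) v = ip w v" for w v
    by (simp add: bounded_linear_Blinfun_apply bounded_linear_ip_right)
  have "bounded_linear (\<lambda>w. Blinfun (ip w))"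
  proof (rule bounded_linear_intro[where K = 1])
    show "Blinfun (ip (x + y)) = Blinfun (ip x) + Blinfun (ip y)" for x y
      by (rule blinfun_eqI) (simp add: riesz_apply blinfun.add_left ip_add_left)
    show "Blinfun (ip (r *\<^sub>R x)) = r *\<^sub>R Blinfun (ip x)" for r x
      by (rule blinfun_eqI) (simp add: riesz_apply blinfun.scaleR_left ip_scaleR_left)
    show "norm (Blinfun (ip x)) \<le> norm x * 1" for x
      by (rule norm_blinfun_bound) (simp_all add: riesz_apply Cauchy_Schwarz)
  qed
  then have "compact ((\<lambda>w. Blinfun (ip w)) ` closure (T ` cball 0 1))"
    using T by (intro compact_continuous_image bounded_linear.continuous_on[OF _ continuous_on_id])
      (simp_all add: compact_operator_def)
  moreover have "(\<lambda>u. Blinfun (ip (T u))) ` cball 0 1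
      \<subseteq> (\<lambda>w. Blinfun (ip w)) ` closure (T ` cball 0 1)"
    using closure_subset[of "T ` cball 0 1"] by blast
  moreover have "vector_space (smul_functional :: 'k \<Rightarrow> ('v \<Rightarrow>\<^sub>L 'k) \<Rightarrow> _)"
    by standard (auto intro!: blinfun_eqI simp: blinfun.bilinear_simps algebra_simps)
  then have "Vector_Spaces.linear smul smul_functional (\<lambda>u. Blinfun (ip (T u)))"
    using T unfolding linear_iff_additive_homogeneous compact_operator_def
    by (auto intro!: blinfun_eqI simp: riesz_apply blinfun.add_left ip_add_left ip_smul_left)
  ultimately show ?thesis by (simp add: compact_operator_def compact_closure_subset)
qed

section \<open>Essential coercivity yields a projection\<close>

text \<open>
  Otherwise the projections \<open>P\<^sub>n\<close> fixing the first \<open>n + 1\<close> members of a dense sequence all fail with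
  the constant \<open>1/(n+1)\<close>. Normalized witnesses \<open>v\<^sub>n\<close> of this failure satisfy \<open>P\<^sub>n v\<^sub>n \<longlonglongrightarrow> 0\<close>, which makes
  them weakly null, because the \<open>P\<^sub>n\<close> are self-adjoint and eventually fix each member of the dense
  sequence.
\<close>
lemma essentially_coercive_imp_projection:
  assumes separable: "separable_space (euclidean :: 'v topology)"
    and a: "sesquilinear_form smul a" and coercive: "essentially_coercive smul a"
  shows "\<exists>P \<alpha>. orthogonal_projection smul ip P \<and> finite_rank smul P \<and> \<alpha> > 0 \<and>
    (\<forall>u. norm (a u u) + (norm (P u))\<^sup>2 \<ge> \<alpha> * (norm u)\<^sup>2)"
proof (rule ccontr)
  assume "\<not> ?thesis"
  then have contra: "\<exists>u. norm (a u u) + (norm (P u))\<^sup>2 < \<alpha> * (norm u)\<^sup>2"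
    if "orthogonal_projection smul ip P" "finite_rank smul P" "\<alpha> > 0" for P \<alpha>
    using that by (meson not_le)
  obtain C :: "'v set" where C: "countable C" "closure C = UNIV"
    using separable by (auto simp: separable_space_def)
  then have "C \<noteq> {}" by auto
  define d where "d = from_nat_into C"
  have range_d: "range d = C" using C(1) \<open>C \<noteq> {}\<close> by (simp add: d_def range_from_nat_into)
  have "\<exists>P. orthogonal_projection smul ip P \<and> finite_rank smul P \<and> (\<forall>k\<le>n. P (d k) = d k)" for n
  proof -
    obtain P where "orthogonal_projection smul ip P" "range P \<subseteq> span (d ` {..n})"
      "\<And>b. b \<in> d ` {..n} \<Longrightarrow> P b = b"
      by (rule ex_projection_fixing[of "d ` {..n}"]) auto
    moreover from this have "finite_rank smul P"
      unfolding finite_rank_def by (intro exI[of _ "d ` {..n}"]) simp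
    ultimately show ?thesis by blast
  qed
  then obtain P where P: "\<And>n. orthogonal_projection smul ip (P n)" "\<And>n. finite_rank smul (P n)"
    "\<And>n k. k \<le> n \<Longrightarrow> P n (d k) = d k" by metis
  have "\<exists>v. norm v = 1 \<and> norm (a v v) + (norm (P n v))\<^sup>2 < 1 / real (Suc n)" for n
  proof -
    obtain u where u: "norm (a u u) + (norm (P n u))\<^sup>2 < 1 / real (Suc n) * (norm u)\<^sup>2"
      using contra[OF P(1,2), of "1 / real (Suc n)"] by auto
    have "0 \<le> norm (a u u) + (norm (P n u))\<^sup>2" by simp
    then have "0 < 1 / real (Suc n) * (norm u)\<^sup>2" using u by linarith
    then have "u \<noteq> 0" by auto
    define r where "r = 1 / norm u"
    have "P n (r *\<^sub>R u) = r *\<^sub>R P n u"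
      using P(1)[of n] by (simp add: orthogonal_projection_def linear_simps)
    then have "norm (a (r *\<^sub>R u) (r *\<^sub>R u)) + (norm (P n (r *\<^sub>R u)))\<^sup>2
        = r\<^sup>2 * (norm (a u u) + (norm (P n u))\<^sup>2)"
      by (simp add: sesquilinear_scaleR_diag[OF a] power_mult_distrib algebra_simps)
    also have "\<dots> < r\<^sup>2 * (1 / real (Suc n) * (norm u)\<^sup>2)"
      by (rule mult_strict_left_mono[OF u]) (use \<open>u \<noteq> 0\<close> in \<open>simp add: r_def\<close>)
    also have "\<dots> = 1 / real (Suc n)" using \<open>u \<noteq> 0\<close> by (simp add: r_def power_divide)
    finally show ?thesis using \<open>u \<noteq> 0\<close> by (intro exI[of _ "r *\<^sub>R u"]) (simp add: r_def)
  qed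
  then obtain v where v: "\<And>n. norm (v n) = 1"
    "\<And>n. norm (a (v n) (v n)) + (norm (P n (v n)))\<^sup>2 < 1 / real (Suc n)" by metis
  have null: "f \<longlonglongrightarrow> 0" if "\<And>n. norm (f n) \<le> 1 / real (Suc n)" for f :: "nat \<Rightarrow> 'c::real_normed_vector"
    by (rule Lim_null_comparison[OF _ lim_1_over_n[THEN LIMSEQ_Suc]]) (use that in simp)
  have a_null: "(\<lambda>n. a (v n) (v n)) \<longlonglongrightarrow> 0"
    using v(2) by (intro null) (smt (verit) zero_le_power2)
  have "(\<lambda>n. (norm (P n (v n)))\<^sup>2) \<longlonglongrightarrow> 0"
    using v(2) by (intro null) (smt (verit) norm_ge_zero real_norm_def zero_le_power2)
  then have P_null: "(\<lambda>n. norm (P n (v n))) \<longlonglongrightarrow> 0"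
    using tendsto_real_sqrt[of _ 0] by fastforce
  have "weakly_converges smul v 0"
    unfolding weakly_converges_def
  proof
    fix L assume "L \<in> antidual smul"
    then obtain w where w: "\<And>x. blinfun_apply L x = ip w x" using Riesz_representation by blast
    have "(\<lambda>n. ip w (v n)) \<longlonglongrightarrow> 0"
    proof (rule LIMSEQ_I)
      fix e :: real assume "e > 0"
      have "w \<in> closure C" using C(2) by simp
      then obtain k where k: "norm (w - d k) < e / 2"
        using \<open>e > 0\<close> unfolding range_d[symmetric] closure_approachable
        by (metis dist_commute dist_norm half_gt_zero rangeE)
      have "(\<lambda>n. norm (d k) * norm (P n (v n))) \<longlonglongrightarrow> 0"
        by (rule tendsto_mult_right_zero[OF P_null])
      then have "\<forall>\<^sub>F n in sequentially. norm (d k) * norm (P n (v n)) < e / 2"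
        by (rule order_tendstoD) (use \<open>e > 0\<close> in simp)
      then obtain N where N: "\<And>n. n \<ge> N \<Longrightarrow> norm (d k) * norm (P n (v n)) < e / 2"
        by (auto simp: eventually_sequentially)
      have "norm (ip w (v n) - 0) < e" if "n \<ge> max N k" for n
      proof -
        have "ip (d k) (v n) = ip (P n (d k)) (v n)" using P(3) that by simp
        also have "\<dots> = ip (d k) (P n (v n))" using P(1)[of n] by (simp add: orthogonal_projection_def)
        finally have "norm (ip (d k) (v n)) < e / 2"
          using Cauchy_Schwarz[of "d k" "P n (v n)"] N[of n] that by simp
        moreover have "norm (ip (w - d k) (v n)) < e / 2"
          using Cauchy_Schwarz[of "w - d k" "v n"] k v(1)[of n] by simp
        moreover have "ip w (v n) = ip (w - d k) (v n) + ip (d k) (v n)" by (simp add: ip_diff_left)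
        ultimately show ?thesis
          using norm_triangle_ineq[of "ip (w - d k) (v n)" "ip (d k) (v n)"] by simp
      qed
      then show "\<exists>N. \<forall>n\<ge>N. norm (ip w (v n) - 0) < e" by blast
    qed
    then show "(\<lambda>n. blinfun_apply L (v n)) \<longlonglongrightarrow> blinfun_apply L 0" by (simp add: w)
  qed
  then have "(\<lambda>n. norm (v n)) \<longlonglongrightarrow> 0"
    using coercive a_null by (auto simp: essentially_coercive_def)
  then show False by (simp add: v(1) LIMSEQ_const_iff)
qed

end

section \<open>The equivalence\<close>

theorem theorem4p3:
  fixes smul :: "'k::real_or_complex \<Rightarrow> 'v::banach \<Rightarrow> 'v"
    and ip :: "'v \<Rightarrow> 'v \<Rightarrow> 'k"
    and a :: "'v \<Rightarrow> 'v \<Rightarrow> 'k"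
  assumes "hilbert_space smul ip"
    and "separable_space (euclidean :: 'v topology)"
    and "sesquilinear_form smul a"
    and "continuous_form a"
  shows
    "(essentially_coercive smul a \<longleftrightarrow>
        (\<exists>P \<alpha>. orthogonal_projection smul ip P \<and> finite_rank smul P \<and> \<alpha> > 0 \<and>
           (\<forall>u. norm (a u u) + (norm (P u))\<^sup>2 \<ge> \<alpha> * (norm u)\<^sup>2))) \<and>
     (essentially_coercive smul a \<longleftrightarrow> coercive_modulo_compact TYPE('v) smul a) \<and>
     (coercive_modulo_compact TYPE('h::banach) smul a \<longrightarrow> essentially_coercive smul a) \<and>
     (essentially_coercive smul a \<longleftrightarrow>
        (\<exists>K \<alpha>. range K \<subseteq> antidual smul \<and> compact_operator smul smul_functional K \<and> \<alpha> > 0 \<and>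
           (\<forall>u. norm (a u u) + norm (blinfun_apply (K u) u) \<ge> \<alpha> * (norm u)\<^sup>2)))"
    (is "(?i \<longleftrightarrow> ?ii) \<and> (?i \<longleftrightarrow> ?iii) \<and> (?iii' \<longrightarrow> ?i) \<and> (?i \<longleftrightarrow> ?iv)")
proof -
  interpret hilbert_space smul ip by (rule assms(1))
  have "?ii" if "?i"
    by (rule essentially_coercive_imp_projection[OF assms(2,3) that])
  moreover have "?iii \<and> ?iv" if "?ii"
  proof -
    obtain P \<alpha> where P: "orthogonal_projection smul ip P" "finite_rank smul P" "\<alpha> > 0"
      and lower: "\<And>u. norm (a u u) + (norm (P u))\<^sup>2 \<ge> \<alpha> * (norm u)\<^sup>2"
      using \<open>?ii\<close> by blast
    have compact: "compact_operator smul smul P"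
      using P(1,2) by (simp add: orthogonal_projection_def finite_rank_imp_compact)
    then have ?iii
      unfolding coercive_modulo_compact_def using assms(1) P(3) lower by blast
    moreover
    define K where "K u = Blinfun (ip (P u))" for u
    have K_apply: "blinfun_apply (K u) v = ip (P u) v" for u v
      by (simp add: K_def bounded_linear_Blinfun_apply bounded_linear_ip_right)
    have "ip (P u) u = ip (P u) (P u)" for u
      using P(1) by (metis comp_apply orthogonal_projection_def)
    then have "norm (blinfun_apply (K u) u) = (norm (P u))\<^sup>2" for u
      by (simp add: K_apply ip_self norm_power)
    moreover have "range K \<subseteq> antidual smul" by (auto simp: antidual_def K_apply ip_smul_right)
    moreover have "compact_operator smul smul_functional K"
      unfolding K_def by (rule compact_operator_Riesz_map[OF compact])
    ultimately show ?thesis using P(3) lower by metis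
  qed
  moreover have "?i" if "?iii"
    using that by (rule coercive_modulo_compact_imp_essentially_coercive[OF assms(3)])
  moreover have "?i" if "?iii'"
    using that by (rule coercive_modulo_compact_imp_essentially_coercive[OF assms(3)])
  moreover have "?i" if "?iv"
    using that compact_functional_imp_essentially_coercive[OF assms(3)] by blast
  ultimately show ?thesis by blast
qed

end
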